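(* Let $T>0$, let $\sigma$ be a convex function on $\mathbb{R}^n$ and let $H(t,p)\in C^1([0,T]\times\mathbb{R}^n)$. Suppose there exists $t_1\in(0,T)$ such that conditions (A1) and (A2) hold on $[0,t_1]\times\mathbb{R}^n$ (with initial function $\sigma$ and $a=0$), and conditions (A1) and (A2) hold on $[t_1,T]\times\mathbb{R}^n$ (with $a=t_1$), where in (A1) on $[t_1,T]\times\mathbb{R}^n$ the function $\sigma$ is replaced by $\omega(\cdot)=u(t_1,\cdot)$. Then the function $$u(t,x)=\begin{cases}\Big(\sigma^*+\int_0^tH(\tau,\cdot)\,d\tau\Big)^*(x), & (t,x)\in[0,t_1]\times\mathbb{R}^n,\\[1ex] \Big(\omega^*+\int_{t_1}^tH(\tau,\cdot)\,d\tau\Big)^*(x), & (t,x)\in[t_1,T]\times\mathbb{R}^n,\end{cases}$$ where $\omega(x)=u(t_1,x)=\big(\sigma^*+\int_0^{t_1}H(\tau,\cdot)d\tau\big)^*(x)$, is a viscosity solution of the Cauchy problem $u_t+H(t,D_xu)=0$ in $(0,T)\times\mathbb{R}^n$, $u(0,x)=\sigma(x)$, $x\in\mathbb{R}^n$.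
   Context: For $f:\mathbb{R}^n\to\mathbb{R}\cup\{+\infty\}$, $f^*(y)=\sup_{q\in\mathbb{R}^n}\{\langle y,q\rangle-f(q)\}$ is the Fenchel conjugate. Conditions on a strip $[a,b]\times\mathbb{R}^n$ with an initial function $\phi$ (convex on $\mathbb{R}^n$): (A1) for every $(t_0,x_0)\in[a,b]\times\mathbb{R}^n$ there exist constants $r>0$, $N>0$ such that $\langle x,p\rangle-\phi^*(p)-\int_a^tH(\tau,p)d\tau<\max_{|q|\le N}\{\langle x,q\rangle-\phi^*(q)-\int_a^tH(\tau,q)d\tau\}$ whenever $(t,x)\in[a,b]\times\mathbb{R}^n$, $|t-t_0|+|x-x_0|<r$, $|p|>N$. (A2) either (a) $H(t,\cdot)$ is convex for all $t\in[a,b]$, or concave for all $t\in[a,b]$; or (b) $H(t,p)=g(t)h(p)+k(t)$ for some functions $g,h,k$ with $g$ not changing sign on $[a,b]$. A viscosity solution of $u_t+H(t,D_xu)=0$ in $(0,T)\times\mathbb{R}^n$, $u(0,\cdot)=\sigma$, is a continuous $u:[0,T]\times\mathbb{R}^n\to\mathbb{R}$ with $u(0,\cdot)=\sigma$ such that for every $v\in C^1((0,T)\times\mathbb{R}^n)$: if $u-v$ has a local maximum at $(t_0,x_0)\in(0,T)\times\mathbb{R}^n$ then $v_t(t_0,x_0)+H(t_0,D_xv(t_0,x_0))\le0$, and if $u-v$ has a local minimum there then $v_t(t_0,x_0)+H(t_0,D_xv(t_0,x_0))\ge0$. *)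

theory Defs
  imports "HOL-Analysis.Analysis" "HOL-Library.Extended_Real"
begin

definition fconj :: "('a::euclidean_space \<Rightarrow> ereal) \<Rightarrow> 'a \<Rightarrow> ereal" where
  "fconj f y = (SUP q. ereal (y \<bullet> q) - f q)"

text \<open>Continuously differentiable on a set S (derivative within S, continuous as a
  map into bounded linear functionals); for closed S this is C^1 up to the boundary.\<close>
definition C1_on :: "'b::real_normed_vector set \<Rightarrow> ('b \<Rightarrow> real) \<Rightarrow> bool" where
  "C1_on S f \<longleftrightarrow> (\<exists>D :: 'b \<Rightarrow> ('b \<Rightarrow>\<^sub>L real).
      continuous_on S D \<and> (\<forall>z\<in>S. (f has_derivative blinfun_apply (D z)) (at z within S)))"

definition condA1 :: "real \<Rightarrow> real \<Rightarrow> ('a::euclidean_space \<Rightarrow> ereal) \<Rightarrow> (real \<Rightarrow> 'a \<Rightarrow> real) \<Rightarrow> bool" where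
  "condA1 a b \<phi> H \<longleftrightarrow>
    (\<forall>t0\<in>{a..b}. \<forall>x0. \<exists>r>0. \<exists>N>0. \<forall>t\<in>{a..b}. \<forall>x p.
       \<bar>t - t0\<bar> + norm (x - x0) < r \<and> norm p > N \<longrightarrow>
       ereal (x \<bullet> p) - fconj \<phi> p - ereal (integral {a..t} (\<lambda>\<tau>. H \<tau> p))
         < (SUP q\<in>cball 0 N. ereal (x \<bullet> q) - fconj \<phi> q - ereal (integral {a..t} (\<lambda>\<tau>. H \<tau> q))))"

definition condA2 :: "real \<Rightarrow> real \<Rightarrow> (real \<Rightarrow> 'a::euclidean_space \<Rightarrow> real) \<Rightarrow> bool" where
  "condA2 a b H \<longleftrightarrow>
    ((\<forall>t\<in>{a..b}. convex_on UNIV (H t)) \<or> (\<forall>t\<in>{a..b}. concave_on UNIV (H t)))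
    \<or> (\<exists>(g::real \<Rightarrow> real) (h::'a \<Rightarrow> real) (k::real \<Rightarrow> real).
         (\<forall>t\<in>{a..b}. \<forall>p. H t p = g t * h p + k t) \<and>
         ((\<forall>t\<in>{a..b}. g t \<ge> 0) \<or> (\<forall>t\<in>{a..b}. g t \<le> 0)))"

definition viscosity_solution ::
    "real \<Rightarrow> (real \<Rightarrow> 'a::euclidean_space \<Rightarrow> real) \<Rightarrow> ('a \<Rightarrow> real) \<Rightarrow> (real \<Rightarrow> 'a \<Rightarrow> real) \<Rightarrow> bool" where
  "viscosity_solution T H \<sigma> u \<longleftrightarrow>
     continuous_on ({0..T} \<times> UNIV) (\<lambda>(t,x). u t x) \<and>
     (\<forall>x. u 0 x = \<sigma> x) \<and>
     (\<forall>v :: real \<Rightarrow> 'a \<Rightarrow> real. C1_on ({0<..<T} \<times> UNIV) (\<lambda>(t,x). v t x) \<longrightarrow>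
        (\<forall>t0 x0 vt p. t0 \<in> {0<..<T} \<and>
           ((\<lambda>(t,x). v t x) has_derivative (\<lambda>(s,h). s * vt + p \<bullet> h)) (at (t0,x0)) \<longrightarrow>
           ((\<exists>e>0. \<forall>t x. t \<in> {0<..<T} \<and> dist (t,x) (t0,x0) < e \<longrightarrow>
                 u t x - v t x \<le> u t0 x0 - v t0 x0) \<longrightarrow> vt + H t0 p \<le> 0) \<and>
           ((\<exists>e>0. \<forall>t x. t \<in> {0<..<T} \<and> dist (t,x) (t0,x0) < e \<longrightarrow>
                 u t x - v t x \<ge> u t0 x0 - v t0 x0) \<longrightarrow> vt + H t0 p \<ge> 0)))"

definition hopf1 :: "('a::euclidean_space \<Rightarrow> real) \<Rightarrow> (real \<Rightarrow> 'a \<Rightarrow> real) \<Rightarrow> real \<Rightarrow> 'a \<Rightarrow> ereal" where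
  "hopf1 \<sigma> H t x = fconj (\<lambda>q. fconj (\<lambda>y. ereal (\<sigma> y)) q + ereal (integral {0..t} (\<lambda>\<tau>. H \<tau> q))) x"

definition omega :: "('a::euclidean_space \<Rightarrow> real) \<Rightarrow> (real \<Rightarrow> 'a \<Rightarrow> real) \<Rightarrow> real \<Rightarrow> 'a \<Rightarrow> ereal" where
  "omega \<sigma> H t1 x = hopf1 \<sigma> H t1 x"

definition hopf2 :: "('a::euclidean_space \<Rightarrow> real) \<Rightarrow> (real \<Rightarrow> 'a \<Rightarrow> real) \<Rightarrow> real \<Rightarrow> real \<Rightarrow> 'a \<Rightarrow> ereal" where
  "hopf2 \<sigma> H t1 t x =
     (if t \<le> t1 then hopf1 \<sigma> H t x
      else fconj (\<lambda>q. fconj (omega \<sigma> H t1) q + ereal (integral {t1..t} (\<lambda>\<tau>. H \<tau> q))) x)"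

end

theory Submission
  imports Defs
begin

text \<open>On each strip \<open>u\<close> is a supremum of the classical solutions
  \<open>x \<bullet> q - c - \<integral> H(\<tau>, q) d\<tau>\<close> with \<open>c\<close> at least the conjugate at \<open>q\<close>, attained locally at
  bounded slopes by (A1). A maximising slope gives the subsolution test directly. For the
  supersolution test, touching from below and a separation argument write the spatial gradient \<open>p\<close>
  as a convex combination of maximising slopes \<open>q\<^sub>i\<close> with \<open>- vt \<le> \<Sum> w\<^sub>i H(t\<^sub>0, q\<^sub>i)\<close>.
  Maximality makes the time integral of the Jensen gap \<open>H(\<tau>, p) - \<Sum> w\<^sub>i H(\<tau>, q\<^sub>i)\<close> nonnegative,
  and by (A2) this gap does not change sign, so it is nonnegative at \<open>t\<^sub>0\<close>. Both tests only look
  at times \<open>t \<le> t\<^sub>0\<close>; hence the gluing time \<open>t1\<close> is covered by the first strip alone.\<close>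

section \<open>Preliminaries: subgradients and derivatives along rays\<close>

text \<open>A hyperplane with normal \<open>(s, t)\<close> separates \<open>(x, f x)\<close> from
  the strict epigraph of \<open>f\<close>. It cannot be vertical because the epigraph has points
  above every \<open>y\<close>, so \<open>t > 0\<close> and \<open>- s / t\<close> is a
  subgradient.\<close>

lemma convex_on_subgradient:
  fixes f :: "'a::euclidean_space \<Rightarrow> real"
  assumes "convex_on UNIV f"
  obtains q where "\<And>y. f x + q \<bullet> (y - x) \<le> f y"
proof -
  let ?S = "{(y, r). f y < r}"
  have "convex ?S"
  proof (rule convexI, clarsimp)
    fix y r y' r' and c d :: real
    assume *: "f y < r" "f y' < r'" "0 \<le> c" "0 \<le> d" "c + d = 1"
    have "f (c *\<^sub>R y + d *\<^sub>R y') \<le> c * f y + d * f y'"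
      using assms * unfolding convex_on_def by auto
    also have "\<dots> < c * r + d * r'"
    proof (cases "c = 0")
      case False
      then have "c * f y < c * r" using * by simp
      moreover have "d * f y' \<le> d * r'" using * by (intro mult_left_mono) auto
      ultimately show ?thesis by linarith
    qed (use * in auto)
    finally show "f (c *\<^sub>R y + d *\<^sub>R y') < c * r + d * r'" .
  qed
  moreover have "(x, f x + 1) \<in> ?S" by simp
  ultimately obtain w b where w: "w \<noteq> 0" "w \<bullet> (x, f x) \<le> b" "\<And>z. z \<in> ?S \<Longrightarrow> b \<le> w \<bullet> z"
    using separating_hyperplane_sets[of "{(x, f x)}" ?S] by fastforce
  obtain s t where st: "w = (s, t)" by fastforce
  have sep: "s \<bullet> x + t * f x \<le> s \<bullet> y + t * (f y + d)" if "d > 0" for y d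
    using w(2) w(3)[of "(y, f y + d)"] that by (simp add: st)
  have "t \<ge> 0" using sep[of 1 x] by (simp add: algebra_simps)
  \<comment> \<open>For a vertical hyperplane, stepping from \<open>x\<close> to
    \<open>x - s\<close> decreases the inner product with \<open>s\<close> unless
    \<open>s = 0\<close>.\<close>
  have "t \<noteq> 0"
  proof
    assume "t = 0"
    then have "s \<bullet> s \<le> 0" using sep[of 1 "x - s"] by (simp add: inner_diff_right)
    then have "s = 0" using inner_ge_zero[of s] by (metis antisym inner_eq_zero_iff)
    then show False using w(1) st \<open>t = 0\<close> by (simp add: zero_prod_def)
  qed
  with \<open>t \<ge> 0\<close> have t: "t > 0" by simp
  have "f x + (- (1/t) *\<^sub>R s) \<bullet> (y - x) \<le> f y" for y
  proof (rule field_le_epsilon)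
    fix d :: real assume "d > 0"
    from sep[OF this, of y] t show "f x + (- (1/t) *\<^sub>R s) \<bullet> (y - x) \<le> f y + d"
      by (simp add: field_simps inner_diff_right)
  qed
  with that show ?thesis by blast
qed

text \<open>This is the chain rule along
  \<open>r \<mapsto> (t0 + r * s, x0 + r *\<^sub>R h)\<close>. It is phrased with sequences because
  the supersolution test passes to subsequences of step sizes.\<close>

lemma has_derivative_ray_tendsto:
  fixes v :: "real \<Rightarrow> 'a::euclidean_space \<Rightarrow> real"
  assumes v: "((\<lambda>(t,x). v t x) has_derivative (\<lambda>(s,h). s * vt + p \<bullet> h)) (at (t0,x0))"
    and e: "e \<longlonglongrightarrow> 0" "\<And>n. e n > (0::real)"
  shows "(\<lambda>n. (v (t0 + e n * s) (x0 + e n *\<^sub>R h) - v t0 x0) / e n) \<longlonglongrightarrow> s * vt + p \<bullet> h"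
proof -
  have g: "((\<lambda>r. (t0 + r * s, x0 + r *\<^sub>R h)) has_derivative (\<lambda>r. (r * s, r *\<^sub>R h))) (at 0)"
    by (auto intro!: derivative_eq_intros)
  have v': "((\<lambda>(t,x). v t x) has_derivative (\<lambda>(s,h). s * vt + p \<bullet> h))
      (at (t0 + 0 * s, x0 + 0 *\<^sub>R h))"
    using v by simp
  have "((\<lambda>r. v (t0 + r * s) (x0 + r *\<^sub>R h)) has_real_derivative s * vt + p \<bullet> h) (at 0)"
    using has_derivative_compose[OF g v'] unfolding has_field_derivative_def
    by (auto simp: distrib_left mult_ac fun_eq_iff intro: has_derivative_eq_rhs)
  then have "((\<lambda>r. (v (t0 + r * s) (x0 + r *\<^sub>R h) - v t0 x0) / r) \<longlongrightarrow> s * vt + p \<bullet> h) (at 0)"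
    by (simp add: has_field_derivative_iff)
  moreover have "filterlim e (at 0) sequentially"
    using e less_imp_neq by (fastforce simp: filterlim_at intro!: always_eventually)
  ultimately show ?thesis by (rule filterlim_compose)
qed

section \<open>The time integral of the Hamiltonian on a strip\<close>

locale strip_hamiltonian =
  fixes a b :: real and H :: "real \<Rightarrow> 'a::euclidean_space \<Rightarrow> real"
  assumes cont_H: "continuous_on ({a..b} \<times> UNIV) (\<lambda>(t,p). H t p)"
begin

definition I :: "real \<Rightarrow> 'a \<Rightarrow> real" where
  "I t q = integral {a..t} (\<lambda>\<tau>. H \<tau> q)"

lemma cont_H_t: "continuous_on {a..b} (\<lambda>\<tau>. H \<tau> q)"
  by (rule continuous_on_compose2[OF cont_H, of _ "\<lambda>\<tau>. (\<tau>, q)", simplified])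
     (auto intro!: continuous_intros)

lemma tendsto_H:
  assumes "t \<longlonglongrightarrow> t0" "q \<longlonglongrightarrow> q0" "\<And>n. t n \<in> {a..b}" "t0 \<in> {a..b}"
  shows "(\<lambda>n. H (t n) (q n)) \<longlonglongrightarrow> H t0 q0"
  using continuous_on_tendsto_compose[OF cont_H tendsto_Pair[OF assms(1,2)]] assms(3,4)
  by simp

lemma I_mvt:
  assumes "a \<le> s" "s \<le> t" "t \<le> b"
  obtains \<tau> where "\<tau> \<in> {s..t}" "I t q - I s q = (t - s) * H \<tau> q"
proof (cases "s = t")
  case True
  then show ?thesis using that[of s] by simp
next
  case False
  have "((\<lambda>t. I t q) has_derivative (*) (H y q)) (at y within {s..t})" if "s \<le> y" "y \<le> t" for y
    using integral_has_real_derivative[OF cont_H_t, of y q] that assms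
    unfolding I_def has_field_derivative_def
    by (auto intro: has_derivative_subset)
  from mvt_simple[of s t "\<lambda>t. I t q", OF _ this] False assms
  obtain \<tau> where "\<tau> \<in> {s<..<t}" "I t q - I s q = H \<tau> q * (t - s)" by auto
  then show ?thesis using that[of \<tau>] by (auto simp: mult.commute)
qed

text \<open>\<open>H\<close> is bounded on the compact set \<open>{a..b} \<times> cball 0 N\<close>,
  and \<open>I_mvt\<close> turns that bound into a Lipschitz constant in time valid for all slopes
  in the ball.\<close>

lemma I_Lipschitz:
  obtains M where "M \<ge> 0" "\<And>s t q. s \<in> {a..b} \<Longrightarrow> t \<in> {a..b} \<Longrightarrow> q \<in> cball 0 N \<Longrightarrow> 
    \<bar>I t q - I s q\<bar> \<le> M * \<bar>t - s\<bar>"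
proof -
  have "compact ((\<lambda>(t,p). H t p) ` ({a..b} \<times> cball 0 N))"
    by (intro compact_continuous_image continuous_on_subset[OF cont_H] compact_Times) auto
  then obtain M where M': "M > 0" "\<forall>y\<in>(\<lambda>(t,p). H t p) ` ({a..b} \<times> cball 0 N). norm y \<le> M"
    using compact_imp_bounded bounded_pos by blast
  have M: "\<bar>H t q\<bar> \<le> M" if "t \<in> {a..b}" "q \<in> cball 0 N" for t q
    using bspec[OF M'(2) imageI[of "(t, q)"]] that by simp
  have *: "\<bar>I t q - I s q\<bar> \<le> M * \<bar>t - s\<bar>" if st: "a \<le> s" "s \<le> t" "t \<le> b" and q: "q \<in> cball 0 N" for s t q
  proof -
    obtain \<tau> where \<tau>: "\<tau> \<in> {s..t}" "I t q - I s q = (t - s) * H \<tau> q" using I_mvt st by blast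
    then have "\<bar>H \<tau> q\<bar> \<le> M" using M st q by auto
    then have "\<bar>t - s\<bar> * \<bar>H \<tau> q\<bar> \<le> \<bar>t - s\<bar> * M" by (rule mult_left_mono) simp
    then show ?thesis using \<tau> by (simp add: abs_mult mult.commute)
  qed
  have "\<bar>I t q - I s q\<bar> \<le> M * \<bar>t - s\<bar>"
    if "s \<in> {a..b}" "t \<in> {a..b}" "q \<in> cball 0 N" for s t q
    using *[of s t q] *[of t s q] that by (cases "s \<le> t") (auto simp: abs_minus_commute)
  with M'(1) that show ?thesis by (meson less_imp_le)
qed

lemma continuous_on_I:
  assumes "t \<in> {a..b}"
  shows "continuous_on UNIV (I t)"
proof -
  have "continuous_on UNIV (\<lambda>q. integral (cbox a t) (\<lambda>\<tau>. H \<tau> q))"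
    by (rule integral_continuous_on_param[of _ _ _ "\<lambda>q \<tau>. H \<tau> q"], unfold split_beta,
        rule continuous_on_compose2[OF cont_H, of _ "\<lambda>z. (snd z, fst z)", simplified])
       (use assms in \<open>auto intro!: continuous_intros\<close>)
  then show ?thesis by (simp add: I_def [abs_def])
qed

text \<open>A convergent sequence of slopes stays in a ball, where \<open>I\<close> is uniformly
  Lipschitz in time; this reduces the claim to continuity in the slope at the fixed time
  \<open>t0\<close>.\<close>

lemma tendsto_I:
  assumes t: "t \<longlonglongrightarrow> t0" and q: "q \<longlonglongrightarrow> q0" and ab: "\<And>n. t n \<in> {a..b}" "t0 \<in> {a..b}"
  shows "(\<lambda>n. I (t n) (q n)) \<longlonglongrightarrow> I t0 q0"
proof -
  obtain N where N: "\<And>n. norm (q n) \<le> N"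
    using convergent_imp_Bseq[OF convergentI[OF q]] by (auto simp: Bseq_def)
  obtain M where M: "\<And>s t q. s \<in> {a..b} \<Longrightarrow> t \<in> {a..b} \<Longrightarrow> q \<in> cball 0 N \<Longrightarrow> \<bar>I t q - I s q\<bar> \<le> M * \<bar>t - s\<bar>"
    using I_Lipschitz by metis
  have "(\<lambda>n. M * \<bar>t n - t0\<bar>) \<longlonglongrightarrow> M * \<bar>t0 - t0\<bar>"
    by (intro tendsto_intros t)
  then have null: "(\<lambda>n. M * \<bar>t n - t0\<bar>) \<longlonglongrightarrow> 0" by simp
  have "norm (I (t n) (q n) - I t0 (q n)) \<le> M * \<bar>t n - t0\<bar>" for n
    using M[OF ab(2) ab(1), of "q n" n] N[of n] by simp
  then have "(\<lambda>n. I (t n) (q n) - I t0 (q n)) \<longlonglongrightarrow> 0"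
    by (intro Lim_null_comparison[OF _ null] always_eventually allI)
  moreover have "(\<lambda>n. I t0 (q n)) \<longlonglongrightarrow> I t0 q0"
    using continuous_on_tendsto_compose[OF continuous_on_I[OF ab(2)] q] by simp
  ultimately show ?thesis using tendsto_add by fastforce
qed

text \<open>A backward time derivative of \<open>I\<close> that tolerates slopes \<open>q n\<close>
  varying with the step: the mean value theorem replaces each quotient by
  \<open>s * H (\<tau> n) (q n)\<close>, and joint continuity of \<open>H\<close> gives the
  limit.\<close>

lemma tendsto_I_quotient:
  assumes e: "e \<longlonglongrightarrow> 0" "\<And>n. e n > (0::real)" and q: "q \<longlonglongrightarrow> q0"
    and t: "t0 \<in> {a..b}" "\<And>n. t0 + e n * s \<in> {a..b}" and s: "s \<le> 0"
  shows "(\<lambda>n. (I (t0 + e n * s) (q n) - I t0 (q n)) / e n) \<longlonglongrightarrow> s * H t0 q0"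
proof -
  have "\<exists>\<tau>. \<tau> \<in> {t0 + e n * s..t0} \<and> I t0 (q n) - I (t0 + e n * s) (q n) = - (e n * s) * H \<tau> (q n)" for n
  proof -
    have "e n * s \<le> 0" using e(2)[of n] s by (simp add: mult_le_0_iff)
    then obtain \<tau> where "\<tau> \<in> {t0 + e n * s..t0}"
        "I t0 (q n) - I (t0 + e n * s) (q n) = (t0 - (t0 + e n * s)) * H \<tau> (q n)"
      using I_mvt[of "t0 + e n * s" t0 "q n"] t(1) t(2)[of n] by auto
    then show ?thesis by (intro exI[of _ \<tau>]) simp
  qed
  then obtain \<tau> where \<tau>: "\<And>n. \<tau> n \<in> {t0 + e n * s..t0}"
      "\<And>n. I t0 (q n) - I (t0 + e n * s) (q n) = - (e n * s) * H (\<tau> n) (q n)" by metis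
  have "(\<lambda>n. t0 + e n * s) \<longlonglongrightarrow> t0 + 0 * s" by (intro tendsto_intros e)
  then have "\<tau> \<longlonglongrightarrow> t0"
    by (intro tendsto_sandwich[of "\<lambda>n. t0 + e n * s" \<tau> sequentially "\<lambda>_. t0"] always_eventually)
       (use \<tau>(1) in auto)
  moreover have "\<tau> n \<in> {a..b}" for n using \<tau>(1)[of n] t(1) t(2)[of n] by auto
  ultimately have "(\<lambda>n. s * H (\<tau> n) (q n)) \<longlonglongrightarrow> s * H t0 q0"
    by (intro tendsto_intros tendsto_H q t)
  moreover have "(I (t0 + e n * s) (q n) - I t0 (q n)) / e n = s * H (\<tau> n) (q n)" for n
    using \<tau>(2)[of n] e(2)[of n] by (simp add: field_simps)
  ultimately show ?thesis by simp
qed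

end

section \<open>Regularity of the Hopf formula on one strip\<close>

text \<open>\<open>E\<close> plays the role of the epigraph of the conjugate of the initial function, so that
  real-valued pairs \<open>(q, c)\<close> replace the extended-real values of the conjugate.\<close>

locale hopf_strip = strip_hamiltonian a b H
  for a b :: real and H :: "real \<Rightarrow> 'a::euclidean_space \<Rightarrow> real" +
  fixes E :: "('a \<times> real) set" and u :: "real \<Rightarrow> 'a \<Rightarrow> real"
  assumes closed_E: "closed E"
    and convex_E: "convex E"
    and upper: "t \<in> {a..b} \<Longrightarrow> (q, c) \<in> E \<Longrightarrow> x \<bullet> q - c - I t q \<le> u t x"
    and locally_attained: "t0 \<in> {a..b} \<Longrightarrow> \<exists>r>0. \<exists>N>0. \<forall>t\<in>{a..b}. \<forall>x.
      \<bar>t - t0\<bar> + norm (x - x0) < r \<longrightarrow> (\<exists>q\<in>cball 0 N. (q, x \<bullet> q - I t q - u t x) \<in> E)"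
begin

lemma attained:
  assumes "t \<in> {a..b}"
  obtains q where "(q, x \<bullet> q - I t q - u t x) \<in> E"
  using locally_attained[OF assms, of x] assms
  by (metis abs_zero add.right_neutral diff_self norm_zero)

text \<open>A slope that is maximising at one point is a competitor at every other point. Since such
  slopes are bounded by \<open>N\<close> near \<open>(t0, x0)\<close>, exchanging the roles of the
  points yields a two-sided Lipschitz estimate.\<close>

lemma u_continuous: "continuous_on ({a..b} \<times> UNIV) (\<lambda>(t,x). u t x)"
proof -
  have "((\<lambda>(t,x). u t x) \<longlongrightarrow> u t0 x0) (at (t0,x0) within {a..b} \<times> UNIV)"
    if t0: "t0 \<in> {a..b}" for t0 x0
  proof -
    obtain r N where r: "r > 0" "N > 0" and q: "\<And>t x. t \<in> {a..b} \<Longrightarrow> \<bar>t - t0\<bar> + norm (x - x0) < r \<Longrightarrow>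
      \<exists>q\<in>cball 0 N. (q, x \<bullet> q - I t q - u t x) \<in> E" using locally_attained[OF t0, of x0] by blast
    obtain M where M: "\<And>s t q. s \<in> {a..b} \<Longrightarrow> t \<in> {a..b} \<Longrightarrow> q \<in> cball 0 N \<Longrightarrow> \<bar>I t q - I s q\<bar> \<le> M * \<bar>t - s\<bar>"
      using I_Lipschitz by metis
    have diff: "u t x - u t' x' \<le> N * norm (x - x') + M * \<bar>t - t'\<bar>"
      if t: "t \<in> {a..b}" "t' \<in> {a..b}" "\<bar>t - t0\<bar> + norm (x - x0) < r" for t x t' x'
    proof -
      obtain q where q: "q \<in> cball 0 N" "(q, x \<bullet> q - I t q - u t x) \<in> E" using q t by blast
      have "x' \<bullet> q - (x \<bullet> q - I t q - u t x) - I t' q \<le> u t' x'" using upper[OF t(2) q(2)] .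
      moreover have "\<bar>I t' q - I t q\<bar> \<le> M * \<bar>t - t'\<bar>"
        using M[OF t(1,2) q(1)] by (simp add: abs_minus_commute)
      moreover have "(x - x') \<bullet> q \<le> N * norm (x - x')"
      proof -
        have "(x - x') \<bullet> q \<le> norm (x - x') * norm q" by (rule norm_cauchy_schwarz)
        also have "\<dots> \<le> norm (x - x') * N" using q(1) by (intro mult_left_mono) auto
        finally show ?thesis by (simp add: mult.commute)
      qed
      ultimately show ?thesis by (simp add: inner_diff_left)
    qed
    let ?F = "at (t0,x0) within {a..b} \<times> UNIV"
    have "((\<lambda>z. \<bar>fst z - t0\<bar> + norm (snd z - x0)) \<longlongrightarrow> \<bar>t0 - t0\<bar> + norm (x0 - x0)) ?F"
      by (intro tendsto_intros) (auto intro!: tendsto_eq_intros)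
    then have "eventually (\<lambda>z. \<bar>fst z - t0\<bar> + norm (snd z - x0) < r) ?F"
      using r(1) by (intro order_tendstoD) auto
    moreover have "eventually (\<lambda>z. fst z \<in> {a..b}) ?F"
      unfolding eventually_at_filter by (rule always_eventually) auto
    ultimately have ev: "eventually (\<lambda>z. norm ((case z of (t,x) \<Rightarrow> u t x) - u t0 x0)
        \<le> N * norm (snd z - x0) + M * \<bar>fst z - t0\<bar>) ?F"
    proof eventually_elim
      case (elim z)
      have "u t0 x0 - u (fst z) (snd z) \<le> N * norm (snd z - x0) + M * \<bar>fst z - t0\<bar>"
        using diff[of t0 "fst z" x0 "snd z"] elim t0 r(1)
        by (simp add: norm_minus_commute abs_minus_commute)
      with diff[of "fst z" t0 "snd z" x0] elim t0 show ?case
        by (simp add: split_beta abs_le_iff)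
    qed
    have "((\<lambda>z. N * norm (snd z - x0) + M * \<bar>fst z - t0\<bar>) \<longlongrightarrow> N * norm (x0 - x0) + M * \<bar>t0 - t0\<bar>) ?F"
      by (intro tendsto_intros) (auto intro!: tendsto_eq_intros)
    then have "((\<lambda>z. (case z of (t,x) \<Rightarrow> u t x) - u t0 x0) \<longlongrightarrow> 0) ?F"
      by (intro Lim_null_comparison[OF ev]) simp
    then show ?thesis using LIM_zero_iff by blast
  qed
  then show ?thesis by (auto simp: continuous_on_def)
qed

lemma tendsto_u:
  assumes "t \<longlonglongrightarrow> t0" "x \<longlonglongrightarrow> x0" "\<And>n. t n \<in> {a..b}" "t0 \<in> {a..b}"
  shows "(\<lambda>n. u (t n) (x n)) \<longlonglongrightarrow> u t0 x0"
  using continuous_on_tendsto_compose[OF u_continuous tendsto_Pair[OF assms(1,2)]] assms(3,4)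
  by simp

text \<open>\<open>u t\<close> is a supremum of functions affine in the space variable: the
  maximiser at the intermediate point is exact there and a lower bound at the two end
  points.\<close>

lemma convex_on_u:
  assumes t: "t \<in> {a..b}"
  shows "convex_on UNIV (u t)"
proof (rule convex_onI)
  fix x y :: 'a and l :: real
  assume l: "0 < l" "l < 1"
  obtain q where q: "(q, ((1 - l) *\<^sub>R x + l *\<^sub>R y) \<bullet> q - I t q - u t ((1 - l) *\<^sub>R x + l *\<^sub>R y)) \<in> E"
    using attained[OF t] by blast
  let ?c = "((1 - l) *\<^sub>R x + l *\<^sub>R y) \<bullet> q - I t q - u t ((1 - l) *\<^sub>R x + l *\<^sub>R y)"
  have "(1 - l) * (x \<bullet> q - ?c - I t q) + l * (y \<bullet> q - ?c - I t q) \<le> (1 - l) * u t x + l * u t y"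
    using l by (intro add_mono mult_left_mono upper[OF t q]) auto
  then show "u t ((1 - l) *\<^sub>R x + l *\<^sub>R y) \<le> (1 - l) * u t x + l * u t y"
    by (simp add: algebra_simps inner_simps)
qed auto

section \<open>Viscosity tests looking backward in time\<close>

lemma small_steps:
  fixes h :: 'a
  assumes t0: "t0 \<in> {a<..b}" and s: "s \<le> 0" and d: "d > (0::real)"
  obtains e :: "nat \<Rightarrow> real" where "e \<longlonglongrightarrow> 0" "\<And>n. e n > 0" "\<And>n. t0 + e n * s \<in> {a<..t0}"
    "\<And>n. \<bar>e n * s\<bar> + norm (e n *\<^sub>R h) < d"
proof -
  have "((\<lambda>r. \<bar>r * s\<bar> + norm (r *\<^sub>R h)) \<longlongrightarrow> \<bar>0 * s\<bar> + norm (0 *\<^sub>R h)) (at_right 0)"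
    by (intro tendsto_intros)
  then have "eventually (\<lambda>r. \<bar>r * s\<bar> + norm (r *\<^sub>R h) < d) (at_right 0)"
    using d by (intro order_tendstoD) auto
  moreover have "((\<lambda>r. t0 + r * s) \<longlongrightarrow> t0 + 0 * s) (at_right 0)"
    by (intro tendsto_intros)
  then have "eventually (\<lambda>r. a < t0 + r * s) (at_right 0)"
    using t0 by (intro order_tendstoD) auto
  ultimately have "eventually (\<lambda>r. \<bar>r * s\<bar> + norm (r *\<^sub>R h) < d \<and> a < t0 + r * s) (at_right 0)"
    by eventually_elim simp
  then obtain c where c: "c > 0" "\<And>r. 0 < r \<Longrightarrow> r < c \<Longrightarrow> \<bar>r * s\<bar> + norm (r *\<^sub>R h) < d \<and> a < t0 + r * s"
    unfolding eventually_at_right_field by blast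
  \<comment> \<open>The shift by 2 keeps even the first step strictly below
    \<open>c\<close>.\<close>
  define e where "e n = c / real (n + 2)" for n
  have e: "0 < e n" "e n < c" for n using c(1) by (auto simp: e_def divide_less_eq)
  have "(\<lambda>n. c / real (n + 2)) \<longlonglongrightarrow> 0"
    using LIMSEQ_ignore_initial_segment[OF lim_const_over_n[of c], of 2] by simp
  then have "e \<longlonglongrightarrow> 0" by (simp add: e_def [abs_def])
  moreover have "t0 + e n * s \<in> {a<..t0}" for n
    using c(2)[OF e] e(1)[of n] s by (auto simp: mult_le_0_iff)
  ultimately show ?thesis using that e c(2) by blast
qed

lemma dist_ray_less:
  assumes "\<bar>e * s\<bar> + norm (e *\<^sub>R h) < d"
  shows "dist (t0 + e * s, x0 + e *\<^sub>R h) (t0, x0) < d"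
  using assms norm_Pair_le[of "e * s" "e *\<^sub>R h"] by (simp add: dist_norm)

text \<open>For a maximising pair \<open>(q, c)\<close> at \<open>(t0, x0)\<close>, the function
  \<open>x \<bullet> q - c - I t q\<close> lies below \<open>u\<close> and touches it there, so its
  increments along backward rays are at most those of \<open>v\<close>.\<close>

lemma subsolution:
  assumes t0: "t0 \<in> {a<..b}"
    and v: "((\<lambda>(t,x). v t x) has_derivative (\<lambda>(s,h). s * vt + p \<bullet> h)) (at (t0,x0))"
    and d: "d > 0" "\<And>t x. t \<in> {a<..t0} \<Longrightarrow> dist (t,x) (t0,x0) < d \<Longrightarrow> u t x - v t x \<le> u t0 x0 - v t0 x0"
  shows "vt + H t0 p \<le> 0"
proof -
  have t0': "t0 \<in> {a..b}" using t0 by auto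
  obtain q where q: "(q, x0 \<bullet> q - I t0 q - u t0 x0) \<in> E"
    using attained[OF t0'] by blast
  have dir: "h \<bullet> q - s * H t0 q \<le> s * vt + p \<bullet> h" if s: "s \<le> 0" for s h
  proof -
    obtain e where e: "e \<longlonglongrightarrow> 0" "\<And>n. e n > 0" "\<And>n. t0 + e n * s \<in> {a<..t0}"
      "\<And>n. \<bar>e n * s\<bar> + norm (e n *\<^sub>R h) < d" using small_steps[OF t0 s d(1)] by blast
    have e': "t0 + e n * s \<in> {a..b}" for n using e(3)[of n] t0 by auto
    have "h \<bullet> q - (I (t0 + e n * s) q - I t0 q) / e n
        \<le> (v (t0 + e n * s) (x0 + e n *\<^sub>R h) - v t0 x0) / e n" for n
    proof -
      have "e n * (h \<bullet> q) - (I (t0 + e n * s) q - I t0 q) \<le> v (t0 + e n * s) (x0 + e n *\<^sub>R h) - v t0 x0"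
        using upper[OF e' q, of "x0 + e n *\<^sub>R h" n] d(2)[OF e(3) dist_ray_less[OF e(4)], of n]
        by (simp add: inner_simps)
      then show ?thesis
        using divide_right_mono[OF _ less_imp_le[OF e(2)[of n]]] e(2)[of n] by (fastforce simp: diff_divide_distrib)
    qed
    moreover have "(\<lambda>n. h \<bullet> q - (I (t0 + e n * s) q - I t0 q) / e n) \<longlonglongrightarrow> h \<bullet> q - s * H t0 q"
      by (intro tendsto_intros tendsto_I_quotient e e' s t0')
    ultimately show ?thesis
      using has_derivative_ray_tendsto[OF v e(1,2)] by (meson LIMSEQ_le)
  qed
  \<comment> \<open>Purely spatial directions are two-sided and force \<open>q = p\<close>; the
    direction \<open>(-1, 0)\<close> then gives the inequality in time.\<close>
  have "(q - p) \<bullet> (q - p) \<le> 0"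
    using dir[of 0 "q - p"] by (simp add: inner_simps inner_commute)
  then have "q - p = 0" by (metis antisym inner_eq_zero_iff inner_ge_zero)
  then have "q = p" by simp
  with dir[of "-1" 0] show ?thesis by simp
qed

text \<open>Convexity of \<open>E\<close> makes the averaged pair a competitor at
  \<open>(t0, x0)\<close>, which bounds the time integral of the Jensen gap \<open>D\<close> below
  by zero. Condition (A2) fixes the sign of \<open>D\<close>, so the bound passes to the single time
  \<open>t0\<close>.\<close>

lemma convex_combination_gap_nonneg:
  assumes t0: "t0 \<in> {a<..b}" and A2: "condA2 a b H"
    and fin: "finite J" and w: "\<And>i. i \<in> J \<Longrightarrow> w i \<ge> 0" "sum w J = (1::real)"
    and q: "\<And>i. i \<in> J \<Longrightarrow> (q i, x0 \<bullet> q i - I t0 (q i) - u t0 x0) \<in> E"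
  shows "(\<Sum>i\<in>J. w i * H t0 (q i)) \<le> H t0 (\<Sum>i\<in>J. w i *\<^sub>R q i)"
proof -
  define p where "p = (\<Sum>i\<in>J. w i *\<^sub>R q i)"
  define D where "D \<tau> = H \<tau> p - (\<Sum>i\<in>J. w i * H \<tau> (q i))" for \<tau>
  have t0': "t0 \<in> {a..b}" using t0 by auto
  have J: "J \<noteq> {}" using w by auto
  have cD: "continuous_on {a..t0} D"
    unfolding D_def using t0 by (intro continuous_intros continuous_on_subset[OF cont_H_t]) auto
  \<comment> \<open>The weights sum to 1, so \<open>k t\<close> cancels; the remaining gap of
    \<open>h\<close> is independent of time and the sign of \<open>g\<close> decides.\<close>
  have D_eq: "D t = g t * (h p - (\<Sum>i\<in>J. w i * h (q i)))"
    if "\<forall>t\<in>{a..b}. \<forall>p. H t p = g t * h p + k t" "t \<in> {a..b}" for g h k t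
  proof -
    have "(\<Sum>i\<in>J. w i * (g t * h (q i) + k t)) = g t * (\<Sum>i\<in>J. w i * h (q i)) + sum w J * k t"
      by (simp add: distrib_left sum.distrib sum_distrib_left sum_distrib_right mult_ac)
    with that w(2) show ?thesis by (simp add: D_def right_diff_distrib)
  qed
  have sign: "(\<forall>\<tau>\<in>{a..b}. D \<tau> \<ge> 0) \<or> (\<forall>\<tau>\<in>{a..b}. D \<tau> \<le> 0)"
    using A2 unfolding condA2_def
  proof (elim disjE exE conjE)
    assume "\<forall>t\<in>{a..b}. convex_on UNIV (H t)"
    then have "\<forall>\<tau>\<in>{a..b}. D \<tau> \<le> 0"
      using convex_on_sum[OF fin J _ w(2) w(1), of UNIV _ q] by (simp add: D_def p_def)
    then show ?thesis ..
  next
    assume "\<forall>t\<in>{a..b}. concave_on UNIV (H t)"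
    then have "\<forall>\<tau>\<in>{a..b}. D \<tau> \<ge> 0"
      using concave_on_sum[OF fin J _ w(2) w(1), of UNIV _ q] by (simp add: D_def p_def)
    then show ?thesis ..
  next
    fix g h k assume H: "\<forall>t\<in>{a..b}. \<forall>p. H t p = g t * h p + k t"
    have "D t = g t * (h p - (\<Sum>i\<in>J. w i * h (q i)))" if "t \<in> {a..b}" for t
      by (rule D_eq[OF H that])
    moreover assume "\<forall>t\<in>{a..b}. 0 \<le> g t"
    ultimately show ?thesis by (cases "h p - (\<Sum>i\<in>J. w i * h (q i)) \<ge> 0") (auto simp: mult_le_0_iff)
  next
    fix g h k assume H: "\<forall>t\<in>{a..b}. \<forall>p. H t p = g t * h p + k t"
    have "D t = g t * (h p - (\<Sum>i\<in>J. w i * h (q i)))" if "t \<in> {a..b}" for t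
      by (rule D_eq[OF H that])
    moreover assume "\<forall>t\<in>{a..b}. g t \<le> 0"
    ultimately show ?thesis by (cases "h p - (\<Sum>i\<in>J. w i * h (q i)) \<ge> 0") (auto simp: mult_le_0_iff zero_le_mult_iff)
  qed
  have "(\<Sum>i\<in>J. w i *\<^sub>R (q i, x0 \<bullet> q i - I t0 (q i) - u t0 x0)) \<in> E"
    using convex_sum[OF fin convex_E w(2) w(1) q] by simp
  moreover have "(\<Sum>i\<in>J. w i *\<^sub>R (q i, x0 \<bullet> q i - I t0 (q i) - u t0 x0))
      = (p, x0 \<bullet> p - (\<Sum>i\<in>J. w i * I t0 (q i)) - u t0 x0)"
    using w(2) by (simp add: p_def sum_prod inner_sum_right right_diff_distrib sum_subtractf flip: sum_distrib_right)
  ultimately have "(\<Sum>i\<in>J. w i * I t0 (q i)) \<le> I t0 p"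
    using upper[OF t0', of p "x0 \<bullet> p - (\<Sum>i\<in>J. w i * I t0 (q i)) - u t0 x0" x0] by simp
  moreover have int: "(\<lambda>\<tau>. H \<tau> y) integrable_on {a..t0}" for y
    using t0 by (intro integrable_continuous_real continuous_on_subset[OF cont_H_t]) auto
  then have "integral {a..t0} D = I t0 p - (\<Sum>i\<in>J. w i * I t0 (q i))"
    unfolding D_def I_def by (simp add: integral_diff integral_sum fin integrable_sum integrable_on_mult_right)
  ultimately have nonneg: "integral {a..t0} D \<ge> 0" by simp
  have "D t0 \<ge> 0"
    using sign
  proof
    \<comment> \<open>With the unfavourable sign the integral must be zero, and a continuous
      function of one sign with zero integral vanishes up to the end point
      \<open>t0\<close>.\<close>
    assume D: "\<forall>\<tau>\<in>{a..b}. D \<tau> \<le> 0"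
    have "integral {a..t0} (\<lambda>\<tau>. - D \<tau>) \<ge> 0"
      using D t0 by (intro integral_nonneg integrable_continuous_real continuous_intros cD) auto
    with nonneg have "integral {a..t0} (\<lambda>\<tau>. - D \<tau>) = 0" by simp
    then have "\<forall>\<tau>\<in>{a..t0}. - D \<tau> = 0"
      using D t0 by (subst (asm) integral_eq_0_iff) (auto intro!: continuous_intros cD)
    then show ?thesis using t0 by auto
  qed (use t0' in auto)
  then show ?thesis by (simp add: D_def p_def)
qed

text \<open>Limits of maximising slopes at backward points give, for each direction
  \<open>(s, h)\<close> with \<open>s \<le> 0\<close>, a maximiser in \<open>Q\<close> whose
  directional derivative is at least that of \<open>v\<close>. Separation turns this family of
  inequalities into one convex combination, to which the gap lemma applies.\<close>

lemma supersolution: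
  assumes t0: "t0 \<in> {a<..b}" and A2: "condA2 a b H"
    and v: "((\<lambda>(t,x). v t x) has_derivative (\<lambda>(s,h). s * vt + p \<bullet> h)) (at (t0,x0))"
    and d: "d > 0" "\<And>t x. t \<in> {a<..t0} \<Longrightarrow> dist (t,x) (t0,x0) < d \<Longrightarrow> u t x - v t x \<ge> u t0 x0 - v t0 x0"
  shows "vt + H t0 p \<ge> 0"
proof -
  have t0': "t0 \<in> {a..b}" using t0 by auto
  obtain r N where r: "r > 0" "N > 0" and att: "\<And>t x. t \<in> {a..b} \<Longrightarrow> \<bar>t - t0\<bar> + norm (x - x0) < r \<Longrightarrow>
      \<exists>q\<in>cball 0 N. (q, x \<bullet> q - I t q - u t x) \<in> E" using locally_attained[OF t0', of x0] by blast
  define Q where "Q = cball 0 N \<inter> {q. (q, x0 \<bullet> q - I t0 q - u t0 x0) \<in> E}"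
  \<comment> \<open>only the directions with \<open>s \<le> 0\<close> are available, so the convex hull is separated from a ray
    rather than from a point\<close>
  have dir: "\<exists>q\<in>Q. s * vt + p \<bullet> h \<le> h \<bullet> q - s * H t0 q" if s: "s \<le> 0" for s h
  proof -
    have "min r d > 0" using r d by simp
    from small_steps[OF t0 s this] obtain e where e: "e \<longlonglongrightarrow> 0" "\<And>n. e n > 0" "\<And>n. t0 + e n * s \<in> {a<..t0}"
      "\<And>n. \<bar>e n * s\<bar> + norm (e n *\<^sub>R h) < min r d" by blast
    define t where "t n = t0 + e n * s" for n
    define x where "x n = x0 + e n *\<^sub>R h" for n
    have t: "t n \<in> {a..b}" for n using e(3)[of n] t0 by (auto simp: t_def)
    \<comment> \<open>The steps stay within distance \<open>r\<close>, so one radius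
      \<open>N\<close> serves all \<open>n\<close> and a subsequence of the slopes
      converges.\<close>
    have "\<exists>q\<in>cball 0 N. (q, x n \<bullet> q - I (t n) q - u (t n) (x n)) \<in> E" for n
      using att[OF t, of n "x n"] e(4)[of n] by (simp add: t_def x_def)
    then obtain q where q: "\<And>n. q n \<in> cball 0 N" "\<And>n. (q n, x n \<bullet> q n - I (t n) (q n) - u (t n) (x n)) \<in> E"
      by metis
    obtain q0 \<rho> where \<rho>: "strict_mono (\<rho> :: nat \<Rightarrow> nat)" "(q \<circ> \<rho>) \<longlonglongrightarrow> q0" "q0 \<in> cball 0 N"
      using compact_cball[of 0 N] q(1) unfolding compact_def by metis
    have e\<rho>: "(\<lambda>n. e (\<rho> n)) \<longlonglongrightarrow> 0" "\<And>n. e (\<rho> n) > 0"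
      using LIMSEQ_subseq_LIMSEQ[OF e(1) \<rho>(1)] e(2) by (auto simp: o_def)
    have q\<rho>: "(\<lambda>n. q (\<rho> n)) \<longlonglongrightarrow> q0" using \<rho>(2) by (simp add: o_def)
    have "(\<lambda>n. t0 + e (\<rho> n) * s) \<longlonglongrightarrow> t0 + 0 * s" "(\<lambda>n. x0 + e (\<rho> n) *\<^sub>R h) \<longlonglongrightarrow> x0 + 0 *\<^sub>R h"
      by (intro tendsto_intros e\<rho>)+
    then have lim: "(\<lambda>n. t (\<rho> n)) \<longlonglongrightarrow> t0" "(\<lambda>n. x (\<rho> n)) \<longlonglongrightarrow> x0"
      by (auto simp: t_def x_def)
    have "(\<lambda>n. (q (\<rho> n), x (\<rho> n) \<bullet> q (\<rho> n) - I (t (\<rho> n)) (q (\<rho> n)) - u (t (\<rho> n)) (x (\<rho> n))))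
        \<longlonglongrightarrow> (q0, x0 \<bullet> q0 - I t0 q0 - u t0 x0)"
      by (intro tendsto_intros tendsto_I tendsto_u lim q\<rho> t t0')
    then have "(q0, x0 \<bullet> q0 - I t0 q0 - u t0 x0) \<in> E"
      by (rule closed_sequentially[OF closed_E q(2)])
    then have "q0 \<in> Q" using \<rho>(3) by (simp add: Q_def)
    \<comment> \<open>The slope \<open>q n\<close> is exact at the displaced point and only a
      competitor at \<open>(t0, x0)\<close>, so it bounds the increment of \<open>u\<close>, and
      hence that of \<open>v\<close>, from above.\<close>
    have "(v (t0 + e n * s) (x0 + e n *\<^sub>R h) - v t0 x0) / e n
        \<le> h \<bullet> q n - (I (t0 + e n * s) (q n) - I t0 (q n)) / e n" for n
    proof -
      have "\<bar>e n * s\<bar> + norm (e n *\<^sub>R h) < d" using e(4)[of n] by simp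
      from d(2)[OF e(3) dist_ray_less[OF this]] upper[OF t0' q(2), of x0 n]
      have "v (t0 + e n * s) (x0 + e n *\<^sub>R h) - v t0 x0
          \<le> e n * (h \<bullet> q n) - (I (t0 + e n * s) (q n) - I t0 (q n))"
        by (simp add: inner_simps t_def x_def)
      then show ?thesis
        using divide_right_mono[OF _ less_imp_le[OF e(2)[of n]]] e(2)[of n] by (fastforce simp: diff_divide_distrib)
    qed
    moreover have "(\<lambda>n. h \<bullet> q (\<rho> n) - (I (t0 + e (\<rho> n) * s) (q (\<rho> n)) - I t0 (q (\<rho> n))) / e (\<rho> n))
        \<longlonglongrightarrow> h \<bullet> q0 - s * H t0 q0"
      using t by (intro tendsto_intros tendsto_I_quotient q\<rho> e\<rho> s t0') (simp add: t_def)
    ultimately have "s * vt + p \<bullet> h \<le> h \<bullet> q0 - s * H t0 q0"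
      using has_derivative_ray_tendsto[OF v e\<rho>] by (meson LIMSEQ_le)
    then show ?thesis using \<open>q0 \<in> Q\<close> by blast
  qed
  \<comment> \<open>The points \<open>(- H t0 q, q)\<close> are the time and space gradients of the
    touching functions. A point of \<open>K\<close> in \<open>R\<close> has spatial part exactly
    \<open>p\<close> and time part at most \<open>vt\<close>.\<close>
  define K where "K = convex hull ((\<lambda>q. (- H t0 q, q)) ` Q)"
  define R where "R = {..vt} \<times> {p}"
  have "closed Q"
  proof -
    have "closed ((\<lambda>q. (q, x0 \<bullet> q - I t0 q - u t0 x0)) -` E)"
      by (intro closed_vimage closed_E continuous_intros continuous_on_I t0')
    then show ?thesis unfolding Q_def vimage_def by (intro closed_Int) auto
  qed
  then have "compact Q" unfolding Q_def by (metis Int_absorb1 compact_Int_closed compact_cball inf_le1)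
  moreover have "continuous_on Q (\<lambda>q. H t0 q)"
    by (rule continuous_on_compose2[OF cont_H, of _ "\<lambda>q. (t0, q)", simplified])
       (use t0' in \<open>auto intro!: continuous_intros\<close>)
  ultimately have "compact K" unfolding K_def
    by (intro compact_convex_hull compact_continuous_image continuous_intros)
  moreover have "K \<noteq> {}" using dir[of 0 0] by (auto simp: K_def)
  moreover have "convex R" "closed R"
    by (auto simp: R_def intro!: convex_Times closed_Times)
  moreover have "convex K" by (simp add: K_def)
  moreover have "R \<inter> K \<noteq> {}"
  proof
    assume "R \<inter> K = {}"
    with calculation obtain w c where w: "\<forall>z\<in>R. w \<bullet> z < c" "\<forall>z\<in>K. c < w \<bullet> z"
      using separating_hyperplane_closed_compact[of R K] by blast
    obtain s h where sh: "w = (s, h)" by fastforce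
    have R: "s * y + h \<bullet> p < c" if "y \<le> vt" for y using w(1) that by (auto simp: R_def sh)
    have Qs: "c < - s * H t0 q + h \<bullet> q" if "q \<in> Q" for q
      using w(2) that hull_inc[of "(- H t0 q, q)" "(\<lambda>q. (- H t0 q, q)) ` Q" convex]
      by (auto simp: K_def sh)
    \<comment> \<open>\<open>R\<close> is unbounded below in time, so a negative \<open>s\<close>
      would make \<open>w\<close> unbounded above on \<open>R\<close>. Hence the direction
      \<open>(- s, - h)\<close> is admissible in \<open>dir\<close>, and the maximiser it provides
      violates the separation.\<close>
    have "s \<ge> 0"
    proof (rule ccontr)
      assume "\<not> s \<ge> 0"
      then have "s < 0" by simp
      define y where "y = min vt ((c - h \<bullet> p) / s)"
      have "y \<le> (c - h \<bullet> p) / s" by (simp add: y_def)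
      then have "s * y \<ge> c - h \<bullet> p" using \<open>s < 0\<close> by (simp add: neg_le_divide_eq mult.commute)
      then show False using R[of y] by (simp add: y_def)
    qed
    then obtain q where "q \<in> Q" "- s * vt + p \<bullet> (- h) \<le> (- h) \<bullet> q - (- s) * H t0 q"
      using dir[of "- s" "- h"] by auto
    with Qs[of q] R[of vt] show False by (simp add: inner_commute)
  qed
  ultimately obtain y where y: "y \<le> vt" "(y, p) \<in> K" by (auto simp: R_def)
  then obtain k w z where z: "\<forall>i\<in>{1::nat..k}. 0 \<le> w i \<and> z i \<in> (\<lambda>q. (- H t0 q, q)) ` Q"
     "sum w {1..k} = 1" "(\<Sum>i=1..k. w i *\<^sub>R z i) = (y, p)"
    unfolding K_def convex_hull_indexed by blast
  define q where "q i = snd (z i)" for i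
  have zq: "q i \<in> Q" "z i = (- H t0 (q i), q i)" if "i \<in> {1..k}" for i
    using bspec[OF z(1) that] by (auto simp: q_def)
  have "(\<Sum>i=1..k. w i *\<^sub>R (- H t0 (q i), q i)) = (y, p)"
    using z(3) zq(2) by (metis (no_types, lifting) sum.cong)
  from arg_cong[OF this, of fst] arg_cong[OF this, of snd]
  have "y = - (\<Sum>i=1..k. w i * H t0 (q i))" "p = (\<Sum>i=1..k. w i *\<^sub>R q i)"
    by (simp_all add: fst_sum snd_sum sum_negf)
  moreover have "(\<Sum>i=1..k. w i * H t0 (q i)) \<le> H t0 (\<Sum>i=1..k. w i *\<^sub>R q i)"
    by (rule convex_combination_gap_nonneg[OF t0 A2]) (use z zq in \<open>auto simp: Q_def\<close>)
  ultimately show ?thesis using y(1) by simp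
qed

end

section \<open>Conjugates and their epigraphs\<close>

lemma fconj_upper: "ereal (x \<bullet> q) - f q \<le> fconj f x"
  unfolding fconj_def by (rule SUP_upper) simp

lemma fconj_real_le_iff:
  "fconj (\<lambda>y. ereal (\<phi> y)) q \<le> ereal c \<longleftrightarrow> (\<forall>y. q \<bullet> y - \<phi> y \<le> c)"
  by (simp add: fconj_def SUP_le_iff)

text \<open>The epigraph of the conjugate of \<open>\<phi>\<close>, written as an intersection of
  closed half-spaces: closedness and convexity can be read off, and slopes with infinite conjugate
  simply have no pair.\<close>

definition conj_epigraph :: "('a::euclidean_space \<Rightarrow> real) \<Rightarrow> ('a \<times> real) set" where
  "conj_epigraph \<phi> = {z. \<forall>y. fst z \<bullet> y - \<phi> y \<le> snd z}"

lemma mem_conj_epigraph: "(q, c) \<in> conj_epigraph \<phi> \<longleftrightarrow> (\<forall>y. q \<bullet> y - \<phi> y \<le> c)"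
  by (simp add: conj_epigraph_def)

lemma closed_conj_epigraph: "closed (conj_epigraph \<phi>)"
  unfolding conj_epigraph_def by (intro closed_Collect_all closed_Collect_le continuous_intros)

lemma convex_conj_epigraph: "convex (conj_epigraph \<phi>)"
proof (rule convexI)
  fix z z' and c d :: real
  assume z: "z \<in> conj_epigraph \<phi>" "z' \<in> conj_epigraph \<phi>" and cd: "0 \<le> c" "0 \<le> d" "c + d = 1"
  have "fst (c *\<^sub>R z + d *\<^sub>R z') \<bullet> y - \<phi> y \<le> snd (c *\<^sub>R z + d *\<^sub>R z')" for y
  proof -
    have "c * (fst z \<bullet> y - \<phi> y) + d * (fst z' \<bullet> y - \<phi> y) \<le> c * snd z + d * snd z'"
      using z cd by (intro add_mono mult_left_mono) (auto simp: conj_epigraph_def)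
    moreover have "c * \<phi> y + d * \<phi> y = \<phi> y" using cd(3) by (simp flip: distrib_right)
    ultimately show ?thesis by (simp add: algebra_simps inner_simps)
  qed
  then show "c *\<^sub>R z + d *\<^sub>R z' \<in> conj_epigraph \<phi>" by (simp add: conj_epigraph_def)
qed

text \<open>At time \<open>a\<close> the integral vanishes and \<open>u a\<close> is the biconjugate
  of \<open>\<phi>\<close>. Attainment gives one inequality, a subgradient of \<open>\<phi>\<close>
  at \<open>x\<close> the other.\<close>

lemma hopf_strip_initial:
  assumes "hopf_strip a b H (conj_epigraph \<phi>) u" "a \<le> b" "convex_on UNIV \<phi>"
  shows "u a x = \<phi> x"
proof (rule antisym)
  interpret hopf_strip a b H "conj_epigraph \<phi>" u by fact
  have a: "a \<in> {a..b}" and I: "I a q = 0" for q using assms(2) by (auto simp: I_def)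
  obtain q where "(q, x \<bullet> q - I a q - u a x) \<in> conj_epigraph \<phi>" using attained[OF a] by blast
  then have "q \<bullet> x - \<phi> x \<le> x \<bullet> q - u a x" by (simp add: mem_conj_epigraph I)
  then show "u a x \<le> \<phi> x" by (simp add: inner_commute)
  obtain q where "\<And>y. \<phi> x + q \<bullet> (y - x) \<le> \<phi> y"
    using convex_on_subgradient[OF assms(3)] by blast
  then have "(q, x \<bullet> q - \<phi> x) \<in> conj_epigraph \<phi>"
    by (simp add: mem_conj_epigraph inner_diff_right inner_commute algebra_simps)
  from upper[OF a this, of x] show "\<phi> x \<le> u a x" by (simp add: I)
qed

section \<open>Finiteness and attainment of the Hopf formula from (A1)\<close>

context strip_hamiltonian
begin

text \<open>\<open>bound\<close> confines the supremum to a compact ball, where it is finite.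
  Near-maximisers accumulate there, and closedness of the epigraph makes the limit a
  maximiser.\<close>

lemma hopf_sup_attained:
  assumes t: "t \<in> {a..b}"
    and bound: "\<And>p. norm p > N \<Longrightarrow> ereal (x \<bullet> p) - fconj (\<lambda>y. ereal (\<phi> y)) p - ereal (I t p)
         < (SUP q\<in>cball 0 N. ereal (x \<bullet> q) - fconj (\<lambda>y. ereal (\<phi> y)) q - ereal (I t q))"
    and N: "N > 0"
  obtains S q where "fconj (\<lambda>q. fconj (\<lambda>y. ereal (\<phi> y)) q + ereal (I t q)) x = ereal S"
    "q \<in> cball 0 N" "(q, x \<bullet> q - I t q - S) \<in> conj_epigraph \<phi>"
proof -
  define F where "F = fconj (\<lambda>y. ereal (\<phi> y))"
  define A where "A q = ereal (x \<bullet> q) - F q - ereal (I t q)" for q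
  \<comment> \<open>Testing the conjugate at the origin keeps \<open>F\<close> away from minus
    infinity and later bounds \<open>A\<close> above on the ball.\<close>
  have F0: "ereal (- \<phi> 0) \<le> F q" for q
    using fconj_upper[of q 0 "\<lambda>y. ereal (\<phi> y)"] by (simp add: F_def)
  then have F: "F q \<noteq> -\<infinity>" for q
    by (metis MInfty_neq_ereal(1) ereal_infty_less_eq(2))
  have "fconj (\<lambda>q. F q + ereal (I t q)) x = (SUP q. A q)"
    unfolding fconj_def[of "\<lambda>q. F q + ereal (I t q)"] A_def
  proof (rule SUP_cong)
    fix q show "ereal (x \<bullet> q) - (F q + ereal (I t q)) = ereal (x \<bullet> q) - F q - ereal (I t q)"
      using F[of q] by (cases "F q") auto
  qed simp
  also have "\<dots> = (SUP q\<in>cball 0 N. A q)"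
  proof (rule antisym)
    show "(SUP q. A q) \<le> (SUP q\<in>cball 0 N. A q)"
    proof (rule SUP_least)
      fix q show "A q \<le> (SUP q\<in>cball 0 N. A q)"
        using bound[of q] unfolding A_def F_def
        by (cases "norm q \<le> N") (auto intro: SUP_upper less_imp_le)
    qed
  qed (rule SUP_subset_mono, auto)
  finally have eq: "fconj (\<lambda>q. F q + ereal (I t q)) x = (SUP q\<in>cball 0 N. A q)" .
  have "compact ((\<lambda>q. x \<bullet> q + \<phi> 0 - I t q) ` cball 0 N)"
    by (intro compact_continuous_image continuous_intros
        continuous_on_subset[OF continuous_on_I[OF t]]) auto
  then obtain B where B: "\<And>q. q \<in> cball 0 N \<Longrightarrow> x \<bullet> q + \<phi> 0 - I t q \<le> B"
    using compact_imp_bounded bounded_real by (metis (no_types, lifting) abs_le_D1 imageI)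
  have "A q \<le> ereal B" if "q \<in> cball 0 N" for q
    using B[OF that] F0[of q] by (cases "F q") (auto simp: A_def)
  then have "(SUP q\<in>cball 0 N. A q) \<le> ereal B" by (rule SUP_least)
  then have "(SUP q\<in>cball 0 N. A q) \<noteq> \<infinity>" by auto
  \<comment> \<open>Any slope outside the ball works: the strict inequality in \<open>bound\<close>
    puts the supremum above minus infinity.\<close>
  moreover obtain p :: 'a where "norm p = N + 1" using vector_choose_size[of "N + 1"] N by auto
  then have "(SUP q\<in>cball 0 N. A q) \<noteq> -\<infinity>" using bound[of p] unfolding A_def F_def by auto
  ultimately obtain S where S: "(SUP q\<in>cball 0 N. A q) = ereal S"
    by (cases "SUP q\<in>cball 0 N. A q") auto
  \<comment> \<open>A slope within \<open>1 / (n + 1)\<close> of the supremum has a finite conjugate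
    value and enters the epigraph with that slack, which tends to zero.\<close>
  have "\<exists>q\<in>cball 0 N. (q, x \<bullet> q - I t q - S + 1 / real (Suc n)) \<in> conj_epigraph \<phi>" for n
  proof -
    have "ereal (S - 1 / real (Suc n)) < (SUP q\<in>cball 0 N. A q)" by (simp add: S)
    then obtain q where q: "q \<in> cball 0 N" "ereal (S - 1 / real (Suc n)) < A q"
      by (auto simp: less_SUP_iff)
    then have "F q \<le> ereal (x \<bullet> q - I t q - S + 1 / real (Suc n))"
      using F[of q] by (cases "F q") (auto simp: A_def)
    then show ?thesis using q(1) by (auto simp: F_def fconj_real_le_iff mem_conj_epigraph)
  qed
  then obtain q where q: "\<And>n. q n \<in> cball 0 N"
      "\<And>n. (q n, x \<bullet> q n - I t (q n) - S + 1 / real (Suc n)) \<in> conj_epigraph \<phi>" by metis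
  obtain q0 \<rho> where \<rho>: "strict_mono (\<rho> :: nat \<Rightarrow> nat)" "(q \<circ> \<rho>) \<longlonglongrightarrow> q0" "q0 \<in> cball 0 N"
    using compact_cball[of 0 N] q(1) unfolding compact_def by metis
  have lim: "(\<lambda>n. q (\<rho> n)) \<longlonglongrightarrow> q0" using \<rho>(2) by (simp add: o_def)
  have "(\<lambda>n. 1 / real (Suc (\<rho> n))) \<longlonglongrightarrow> 0"
    using LIMSEQ_subseq_LIMSEQ[OF LIMSEQ_Suc[OF lim_1_over_n] \<rho>(1)] by (simp add: o_def)
  then have "(\<lambda>n. (q (\<rho> n), x \<bullet> q (\<rho> n) - I t (q (\<rho> n)) - S + 1 / real (Suc (\<rho> n))))
      \<longlonglongrightarrow> (q0, x \<bullet> q0 - I t q0 - S + 0)"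
    by (intro tendsto_intros tendsto_I lim t)
  then have "(q0, x \<bullet> q0 - I t q0 - S + 0) \<in> conj_epigraph \<phi>"
    by (rule closed_sequentially[OF closed_conj_epigraph q(2)])
  with that eq S \<rho>(3) show ?thesis by (simp add: F_def)
qed

lemma hopf_strip_exists:
  assumes A1: "condA1 a b (\<lambda>y. ereal (\<phi> y)) H"
  obtains u where "hopf_strip a b H (conj_epigraph \<phi>) u"
    "\<And>t x. t \<in> {a..b} \<Longrightarrow>
      fconj (\<lambda>q. fconj (\<lambda>y. ereal (\<phi> y)) q + ereal (integral {a..t} (\<lambda>\<tau>. H \<tau> q))) x = ereal (u t x)"
proof -
  define G where "G t = fconj (\<lambda>q. fconj (\<lambda>y. ereal (\<phi> y)) q + ereal (I t q))" for t
  define u where "u t x = real_of_ereal (G t x)" for t x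
  have loc: "\<exists>r>0. \<exists>N>0. \<forall>t\<in>{a..b}. \<forall>x. \<bar>t - t0\<bar> + norm (x - x0) < r \<longrightarrow>
      G t x = ereal (u t x) \<and> (\<exists>q\<in>cball 0 N. (q, x \<bullet> q - I t q - u t x) \<in> conj_epigraph \<phi>)"
    if t0: "t0 \<in> {a..b}" for t0 x0
  proof -
    obtain r N where rN: "r > 0" "N > 0" and *: "\<And>t x p. t \<in> {a..b} \<Longrightarrow> \<bar>t - t0\<bar> + norm (x - x0) < r \<Longrightarrow>
       norm p > N \<Longrightarrow> ereal (x \<bullet> p) - fconj (\<lambda>y. ereal (\<phi> y)) p - ereal (I t p)
         < (SUP q\<in>cball 0 N. ereal (x \<bullet> q) - fconj (\<lambda>y. ereal (\<phi> y)) q - ereal (I t q))"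
      using A1 t0 unfolding condA1_def I_def by meson
    have "G t x = ereal (u t x) \<and> (\<exists>q\<in>cball 0 N. (q, x \<bullet> q - I t q - u t x) \<in> conj_epigraph \<phi>)"
      if t: "t \<in> {a..b}" "\<bar>t - t0\<bar> + norm (x - x0) < r" for t x
    proof -
      obtain S q where "G t x = ereal S" "q \<in> cball 0 N" "(q, x \<bullet> q - I t q - S) \<in> conj_epigraph \<phi>"
        using hopf_sup_attained[OF t(1) *[OF t] rN(2)] unfolding G_def by metis
      then show ?thesis by (auto simp: u_def)
    qed
    with rN show ?thesis by blast
  qed
  \<comment> \<open>Taking each point as its own centre in \<open>loc\<close> shows that
    \<open>real_of_ereal\<close> never discards an infinite value on the strip.\<close>
  have G: "G t x = ereal (u t x)" if t: "t \<in> {a..b}" for t x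
    using loc[OF t, of x] t by (metis abs_zero add.right_neutral diff_self norm_zero)
  have "hopf_strip a b H (conj_epigraph \<phi>) u"
  proof unfold_locales
    fix t q c x assume t: "t \<in> {a..b}" and "(q, c) \<in> conj_epigraph \<phi>"
    then have "fconj (\<lambda>y. ereal (\<phi> y)) q \<le> ereal c"
      by (simp add: fconj_real_le_iff mem_conj_epigraph)
    then have "ereal (x \<bullet> q - c - I t q) \<le> ereal (x \<bullet> q) - (fconj (\<lambda>y. ereal (\<phi> y)) q + ereal (I t q))"
      by (cases "fconj (\<lambda>y. ereal (\<phi> y)) q") auto
    also have "\<dots> \<le> G t x"
      unfolding G_def by (rule fconj_upper)
    finally show "x \<bullet> q - c - I t q \<le> u t x" by (simp add: G[OF t])
  next
    fix t0 x0 assume "t0 \<in> {a..b}"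
    from loc[OF this, of x0] show "\<exists>r>0. \<exists>N>0. \<forall>t\<in>{a..b}. \<forall>x. \<bar>t - t0\<bar> + norm (x - x0) < r \<longrightarrow>
      (\<exists>q\<in>cball 0 N. (q, x \<bullet> q - I t q - u t x) \<in> conj_epigraph \<phi>)" by blast
  qed (rule closed_conj_epigraph convex_conj_epigraph)+
  with that[of u] G show ?thesis by (simp add: G_def I_def)
qed

end

section \<open>Gluing the two strips\<close>

lemma C1_on_imp_continuous_on: "C1_on S f \<Longrightarrow> continuous_on S f"
  unfolding C1_on_def by (meson has_derivative_continuous continuous_on_eq_continuous_within)

theorem theorem3p3:
  fixes T t1 :: real
    and \<sigma> :: "'a::euclidean_space \<Rightarrow> real"
    and H :: "real \<Rightarrow> 'a \<Rightarrow> real"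
  assumes "T > 0"
    and "convex_on UNIV \<sigma>"
    and "C1_on ({0..T} \<times> UNIV) (\<lambda>(t,p). H t p)"
    and "t1 \<in> {0<..<T}"
    and "condA1 0 t1 (\<lambda>y. ereal (\<sigma> y)) H"
    and "condA2 0 t1 H"
    and "condA1 t1 T (omega \<sigma> H t1) H"
    and "condA2 t1 T H"
  shows "\<exists>u :: real \<Rightarrow> 'a \<Rightarrow> real.
           (\<forall>t\<in>{0..T}. \<forall>x. hopf2 \<sigma> H t1 t x = ereal (u t x)) \<and>
           viscosity_solution T H \<sigma> u"
proof -
  have t1: "0 < t1" "t1 < T" using assms(4) by auto
  have cont: "continuous_on ({0..T} \<times> UNIV) (\<lambda>(t,p). H t p)"
    by (rule C1_on_imp_continuous_on[OF assms(3)])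
  interpret A: strip_hamiltonian 0 t1 H
    by unfold_locales (rule continuous_on_subset[OF cont], use t1 in auto)
  interpret B: strip_hamiltonian t1 T H
    by unfold_locales (rule continuous_on_subset[OF cont], use t1 in auto)
  obtain u1 where "hopf_strip 0 t1 H (conj_epigraph \<sigma>) u1"
    and u1: "\<And>t x. t \<in> {0..t1} \<Longrightarrow> hopf1 \<sigma> H t x = ereal (u1 t x)"
    using A.hopf_strip_exists[OF assms(5)] unfolding hopf1_def by metis
  then interpret A: hopf_strip 0 t1 H "conj_epigraph \<sigma>" u1 by simp
  \<comment> \<open>Finiteness on the first strip makes \<open>omega\<close> a real function, so the
    second strip is again an instance with initial function \<open>u1 t1\<close>.\<close>
  have omega: "omega \<sigma> H t1 = (\<lambda>x. ereal (u1 t1 x))"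
    using u1 t1 by (auto simp: omega_def)
  obtain u2 where "hopf_strip t1 T H (conj_epigraph (u1 t1)) u2"
    and u2: "\<And>t x. t \<in> {t1..T} \<Longrightarrow>
      fconj (\<lambda>q. fconj (omega \<sigma> H t1) q + ereal (integral {t1..t} (\<lambda>\<tau>. H \<tau> q))) x = ereal (u2 t x)"
    using B.hopf_strip_exists[OF assms(7)[unfolded omega]] unfolding omega by metis
  then interpret B: hopf_strip t1 T H "conj_epigraph (u1 t1)" u2 by simp
  have init1: "u1 0 x = \<sigma> x" for x
    by (rule hopf_strip_initial[OF A.hopf_strip_axioms _ assms(2)]) (use t1 in simp)
  \<comment> \<open>\<open>u1 t1\<close> is convex by \<open>convex_on_u\<close>, so the second
    formula starts exactly at it and the two pieces agree at \<open>t1\<close>.\<close>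
  have init2: "u2 t1 x = u1 t1 x" for x
    by (rule hopf_strip_initial[OF B.hopf_strip_axioms]) (use t1 A.convex_on_u[of t1] in auto)
  define u where "u t x = (if t \<le> t1 then u1 t x else u2 t x)" for t x
  have uB: "u t x = u2 t x" if "t \<ge> t1" for t x using that init2 by (auto simp: u_def)
  have "continuous_on ({0..t1} \<times> UNIV \<union> {t1..T} \<times> UNIV) (\<lambda>(t,x). u t x)"
  proof (rule continuous_on_closed_Un)
    show "continuous_on ({0..t1} \<times> UNIV) (\<lambda>(t,x). u t x)"
      by (rule continuous_on_eq[OF A.u_continuous]) (auto simp: u_def)
    show "continuous_on ({t1..T} \<times> UNIV) (\<lambda>(t,x). u t x)"
      by (rule continuous_on_eq[OF B.u_continuous]) (auto simp: uB)
  qed (auto intro!: closed_Times)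
  moreover have "{0..t1} \<times> UNIV \<union> {t1..T} \<times> UNIV = {0..T} \<times> (UNIV :: 'a set)" using t1 by auto
  ultimately have cont_u: "continuous_on ({0..T} \<times> UNIV) (\<lambda>(t,x). u t x)" by simp
  have sub_test: "vt + H t0 p \<le> 0"
    if t0: "t0 \<in> {0<..<T}" and v: "((\<lambda>(t,x). v t x) has_derivative (\<lambda>(s,h). s * vt + p \<bullet> h)) (at (t0,x0))"
      and e: "e > 0" "\<And>t x. t \<in> {0<..<T} \<Longrightarrow> dist (t,x) (t0,x0) < e \<Longrightarrow> u t x - v t x \<le> u t0 x0 - v t0 x0"
    for v :: "real \<Rightarrow> 'a \<Rightarrow> real" and t0 x0 vt p e
  \<comment> \<open>The value \<open>t0 = t1\<close> goes to the first strip, whose test only uses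
    times up to \<open>t0\<close>.\<close>
  proof (cases "t0 \<le> t1")
    case True
    show ?thesis
    proof (rule A.subsolution[OF _ v e(1)])
      fix t x assume "t \<in> {0<..t0}" "dist (t,x) (t0,x0) < e"
      then show "u1 t x - v t x \<le> u1 t0 x0 - v t0 x0" using e(2)[of t x] t0 True by (simp add: u_def)
    qed (use t0 True in simp)
  next
    case False
    show ?thesis
    proof (rule B.subsolution[OF _ v e(1)])
      fix t x assume "t \<in> {t1<..t0}" "dist (t,x) (t0,x0) < e"
      then show "u2 t x - v t x \<le> u2 t0 x0 - v t0 x0" using e(2)[of t x] t0 t1 False by (simp add: u_def)
    qed (use t0 False in simp)
  qed
  have super_test: "vt + H t0 p \<ge> 0"
    if t0: "t0 \<in> {0<..<T}" and v: "((\<lambda>(t,x). v t x) has_derivative (\<lambda>(s,h). s * vt + p \<bullet> h)) (at (t0,x0))"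
      and e: "e > 0" "\<And>t x. t \<in> {0<..<T} \<Longrightarrow> dist (t,x) (t0,x0) < e \<Longrightarrow> u t x - v t x \<ge> u t0 x0 - v t0 x0"
    for v :: "real \<Rightarrow> 'a \<Rightarrow> real" and t0 x0 vt p e
  proof (cases "t0 \<le> t1")
    case True
    show ?thesis
    proof (rule A.supersolution[OF _ assms(6) v e(1)])
      fix t x assume "t \<in> {0<..t0}" "dist (t,x) (t0,x0) < e"
      then show "u1 t x - v t x \<ge> u1 t0 x0 - v t0 x0" using e(2)[of t x] t0 True by (simp add: u_def)
    qed (use t0 True in simp)
  next
    case False
    show ?thesis
    proof (rule B.supersolution[OF _ assms(8) v e(1)])
      fix t x assume "t \<in> {t1<..t0}" "dist (t,x) (t0,x0) < e"
      then show "u2 t x - v t x \<ge> u2 t0 x0 - v t0 x0" using e(2)[of t x] t0 t1 False by (simp add: u_def)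
    qed (use t0 False in simp)
  qed
  show ?thesis
  proof (intro exI[of _ u] conjI ballI allI)
    fix t x assume "t \<in> {0..T}"
    then show "hopf2 \<sigma> H t1 t x = ereal (u t x)"
      using u1[of t x] u2[of t x] by (simp add: hopf2_def u_def)
  next
    show "viscosity_solution T H \<sigma> u"
      unfolding viscosity_solution_def
    proof (intro conjI allI impI; (elim conjE exE)?)
      show "continuous_on ({0..T} \<times> UNIV) (\<lambda>(t,x). u t x)" by (rule cont_u)
      show "u 0 x = \<sigma> x" for x using init1 t1 by (simp add: u_def)
    qed ((rule sub_test super_test, assumption+, blast)+)
  qed
qed

end
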